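(* Let $\Gamma$ be a Fuchsian group of the first kind, and let $f$ be a nonzero rational function of $z\in\mathbb{H}$. Let $k\in\mathbb{R}$ and let $\nu$ be a multiplier system of weight $k$ for $\Gamma$. Then $f$ is an unrestricted automorphic form for $\Gamma$ of weight $k$ and multiplier system $\nu$ if and only if $k=0$, $\nu=1$, and $f$ is a constant.
   Context: $\mathbb{H}$ is the upper half-plane; $\mathrm{PSL}_2(\mathbb{R})=\mathrm{SL}_2(\mathbb{R})/\{\pm I\}$ acts on $\mathbb{H}\cup\mathbb{R}\cup\{\infty\}$ by Möbius transformations. A Fuchsian group is a discrete subgroup $\Gamma$ of $\mathrm{PSL}_2(\mathbb{R})$; its limit set is the set of all limit points of orbits $\Gamma z$, $z\in\mathbb{H}$; it is of the first kind if its limit set is $\mathbb{R}\cup\{\infty\}$. Let $\widetilde\Gamma\subset\mathrm{SL}_2(\mathbb{R})$ be the preimage of $\Gamma$. Real powers $(cz+d)^k$ are taken with the principal branch of the logarithm. A multiplier system of weight $k\in\mathbb{R}$ for $\Gamma$ is a function $\nu:\widetilde\Gamma\to\{w\in\mathbb{C}:|w|=1\}$ such that $\mu_\gamma(z)=\nu(\gamma)(cz+d)^k$, for $\gamma=\begin{pmatrix}a&b\\c&d\end{pmatrix}\in\widetilde\Gamma$ and $z\in\mathbb{H}$, satisfies $\mu_{\alpha\gamma}(z)=\mu_\alpha(\gamma z)\mu_\gamma(z)$ and $\mu_{-\gamma}(z)=\mu_\gamma(z)$ for all $\alpha,\gamma\in\widetilde\Gamma$, $z\in\mathbb{H}$.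 An unrestricted automorphic form for $\Gamma$ of weight $k$ and multiplier system $\nu$ is a meromorphic function $f$ on $\mathbb{H}$ with $(cz+d)^{-k}f(\gamma z)=\nu(\gamma)f(z)$ for all $\gamma=\begin{pmatrix}a&b\\c&d\end{pmatrix}\in\widetilde\Gamma$. *)

theory Defs
  imports
    "HOL-Complex_Analysis.Complex_Analysis"
    "HOL-Computational_Algebra.Computational_Algebra"
    "HOL-Algebra.Coset"
begin

definition upper_half_plane :: "complex set" where
  "upper_half_plane = {z. Im z > 0}"

definition SL2R :: "(real ^ 2 ^ 2) monoid" where
  "SL2R = \<lparr>carrier = {A. det A = 1}, mult = (**), one = mat 1\<rparr>"

definition PSL2R :: "(real ^ 2 ^ 2) set monoid" where
  "PSL2R = SL2R Mod {mat 1, - mat 1}"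

abbreviation SL2R_to_PSL2R :: "real ^ 2 ^ 2 \<Rightarrow> (real ^ 2 ^ 2) set" where
  "SL2R_to_PSL2R A \<equiv> {mat 1, - mat 1} #>\<^bsub>SL2R\<^esub> A"

text \<open>The quotient topology on \<open>PSL2R\<close>, where \<open>SL2R\<close> is topologised as a
  subspace of the space of real matrices.\<close>

definition PSL2R_topology :: "(real ^ 2 ^ 2) set topology" where
  "PSL2R_topology = topology (\<lambda>U. U \<subseteq> carrier PSL2R \<and>
     openin (top_of_set (carrier SL2R)) {A \<in> carrier SL2R. SL2R_to_PSL2R A \<in> U})"

definition SL2R_preimage :: "(real ^ 2 ^ 2) set set \<Rightarrow> (real ^ 2 ^ 2) set" where
  "SL2R_preimage \<Gamma> = {A \<in> carrier SL2R. SL2R_to_PSL2R A \<in> \<Gamma>}"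

definition mat_moebius :: "real ^ 2 ^ 2 \<Rightarrow> complex \<Rightarrow> complex" where
  "mat_moebius A = moebius (of_real (A $ 1 $ 1)) (of_real (A $ 1 $ 2))
                           (of_real (A $ 2 $ 1)) (of_real (A $ 2 $ 2))"

definition fuchsian_group :: "(real ^ 2 ^ 2) set set \<Rightarrow> bool" where
  "fuchsian_group \<Gamma> \<longleftrightarrow>
     subgroup \<Gamma> PSL2R \<and> subtopology PSL2R_topology \<Gamma> = discrete_topology \<Gamma>"

definition orbit_upper_half_plane :: "(real ^ 2 ^ 2) set set \<Rightarrow> complex \<Rightarrow> complex set" where
  "orbit_upper_half_plane \<Gamma> z = (\<lambda>A. mat_moebius A z) ` SL2R_preimage \<Gamma>"

text \<open>Limit points are taken in the Riemann sphere, the one-point compactification of the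
  complex plane with \<open>None\<close> as the point at infinity. The union of the upper half-plane, the
  real line and infinity is closed in the sphere, so it contains all limit points of orbits.\<close>

definition riemann_sphere :: "complex option topology" where
  "riemann_sphere = Alexandroff_compactification euclidean"

definition limit_set :: "(real ^ 2 ^ 2) set set \<Rightarrow> complex option set" where
  "limit_set \<Gamma> = (\<Union>z\<in>upper_half_plane.
     riemann_sphere derived_set_of (Some ` orbit_upper_half_plane \<Gamma> z))"

definition first_kind :: "(real ^ 2 ^ 2) set set \<Rightarrow> bool" where
  "first_kind \<Gamma> \<longleftrightarrow> limit_set \<Gamma> = insert None (Some ` (\<real> :: complex set))"

text \<open>The library's complex \<open>powr\<close> uses the principal logarithm, with imaginary part in
  \<open>(-pi, pi]\<close>.\<close>

definition automorphy_power :: "real \<Rightarrow> real ^ 2 ^ 2 \<Rightarrow> complex \<Rightarrow> complex" where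
  "automorphy_power k A z =
     (of_real (A $ 2 $ 1) * z + of_real (A $ 2 $ 2)) powr (of_real k)"

text \<open>Only the values of \<open>\<nu>\<close> on the preimage of \<open>\<Gamma>\<close> matter.\<close>

definition multiplier_system ::
  "(real ^ 2 ^ 2) set set \<Rightarrow> real \<Rightarrow> (real ^ 2 ^ 2 \<Rightarrow> complex) \<Rightarrow> bool" where
  "multiplier_system \<Gamma> k \<nu> \<longleftrightarrow>
     (let \<mu> = (\<lambda>A z. \<nu> A * automorphy_power k A z) in
       (\<forall>A\<in>SL2R_preimage \<Gamma>. cmod (\<nu> A) = 1) \<and>
       (\<forall>A\<in>SL2R_preimage \<Gamma>. \<forall>B\<in>SL2R_preimage \<Gamma>. \<forall>z\<in>upper_half_plane.
          \<mu> (A ** B) z = \<mu> A (mat_moebius B z) * \<mu> B z) \<and>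
       (\<forall>A\<in>SL2R_preimage \<Gamma>. \<forall>z\<in>upper_half_plane. \<mu> (- A) z = \<mu> A z))"

text \<open>A meromorphic function is represented by the total function that has removable
  singularities removed and takes the value 0 at its poles. Moebius maps preserve the poles
  of an automorphic form, so at a pole the transformation law reads \<open>0 = 0\<close>.\<close>

definition unrestricted_automorphic_form ::
  "(real ^ 2 ^ 2) set set \<Rightarrow> real \<Rightarrow> (real ^ 2 ^ 2 \<Rightarrow> complex) \<Rightarrow> (complex \<Rightarrow> complex) \<Rightarrow> bool" where
  "unrestricted_automorphic_form \<Gamma> k \<nu> f \<longleftrightarrow>
     f nicely_meromorphic_on upper_half_plane \<and>
     (\<forall>A\<in>SL2R_preimage \<Gamma>. \<forall>z\<in>upper_half_plane.
        automorphy_power (- k) A z * f (mat_moebius A z) = \<nu> A * f z)"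

text \<open>Coprimality makes the quotient agree with the above representation of meromorphic
  functions: it has no removable singularities, and division by zero yields 0 at the poles.\<close>

definition rational_function_on :: "(complex \<Rightarrow> complex) \<Rightarrow> complex set \<Rightarrow> bool" where
  "rational_function_on f S \<longleftrightarrow>
     (\<exists>p q. q \<noteq> 0 \<and> coprime p q \<and> (\<forall>z\<in>S. f z = poly p z / poly q z))"

lemma group_SL2R: "group SL2R"
proof (rule groupI)
  fix A assume A: "A \<in> carrier SL2R"
  then have "invertible A" by (simp add: SL2R_def invertible_det_nz)
  then obtain B where "A ** B = mat 1" "B ** A = mat 1" by (auto simp: invertible_def)
  moreover from this have "det B = 1" using A det_mul[of A B] by (simp add: SL2R_def)
  ultimately show "\<exists>B\<in>carrier SL2R. B \<otimes>\<^bsub>SL2R\<^esub> A = \<one>\<^bsub>SL2R\<^esub>"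
    by (auto simp: SL2R_def)
qed (auto simp: SL2R_def det_mul matrix_mul_assoc)

lemma minus_mult_2: "(- A) ** B = - (A ** B)" "A ** (- B) = - (A ** B)"
  for A B :: "real ^ 2 ^ 2"
  by (simp_all add: matrix_matrix_mult_def vec_eq_iff sum_negf)

lemma det_minus_2: "det (- A) = det A" for A :: "real ^ 2 ^ 2"
  by (simp add: det_2)

lemma normal_center: "{mat 1, - mat 1} \<lhd> SL2R"
proof -
  interpret group SL2R by (rule group_SL2R)
  have "subgroup {mat 1, - mat 1} SL2R"
    by (rule subgroupI)
       (auto simp: SL2R_def minus_mult_2 det_minus_2
         intro!: inv_equality[unfolded SL2R_def, simplified] intro: inv_equality)
  then show ?thesis
    by (rule normalI) (auto simp: r_coset_def l_coset_def SL2R_def minus_mult_2)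
qed

lemma SL2R_to_PSL2R_eq: "SL2R_to_PSL2R A = {A, - A}"
  by (auto simp: r_coset_def SL2R_def minus_mult_2)

lemma group_PSL2R: "group PSL2R"
  unfolding PSL2R_def by (rule normal.factorgroup_is_group[OF normal_center])

lemma openin_PSL2R_topology:
  "openin PSL2R_topology U \<longleftrightarrow> U \<subseteq> carrier PSL2R \<and>
     openin (top_of_set (carrier SL2R)) {A \<in> carrier SL2R. SL2R_to_PSL2R A \<in> U}"
  (is "_ \<longleftrightarrow> ?P U")
proof -
  let ?S = "carrier SL2R"
  have "istopology ?P"
    unfolding istopology_def
  proof (intro conjI allI impI)
    fix U V assume "?P U" "?P V"
    moreover have "{A \<in> ?S. SL2R_to_PSL2R A \<in> U \<inter> V} =
        {A \<in> ?S. SL2R_to_PSL2R A \<in> U} \<inter> {A \<in> ?S. SL2R_to_PSL2R A \<in> V}"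
      by auto
    ultimately show "U \<inter> V \<subseteq> carrier PSL2R"
      and "openin (top_of_set ?S) {A \<in> ?S. SL2R_to_PSL2R A \<in> U \<inter> V}"
      by (auto simp only: openin_Int)
  next
    fix \<U> assume \<U>: "\<forall>U\<in>\<U>. ?P U"
    then show "\<Union>\<U> \<subseteq> carrier PSL2R" by blast
    have "{A \<in> ?S. SL2R_to_PSL2R A \<in> \<Union>\<U>} = (\<Union>U\<in>\<U>. {A \<in> ?S. SL2R_to_PSL2R A \<in> U})"
      by auto
    then show "openin (top_of_set ?S) {A \<in> ?S. SL2R_to_PSL2R A \<in> \<Union>\<U>}"
      using \<U> by (auto simp only: intro!: openin_Union)
  qed
  then show ?thesis
    by (simp add: PSL2R_topology_def topology_inverse')
qed

end

theory Submission
  imports Defs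
begin

text \<open>Let \<open>f = p / q\<close> and let \<open>x\<close> be a real number that is not a root of \<open>p q\<close>. The function
  \<open>h z = \<bar>f z\<bar> (Im z) powr (k / 2)\<close> is invariant under \<open>\<Gamma>\<close>. As \<open>x\<close> is a limit point, there are
  \<open>\<gamma>\<^sub>n\<close> in \<open>\<Gamma>\<close> and \<open>z\<close> with \<open>\<gamma>\<^sub>n z \<longlonglongrightarrow> x\<close>; along this orbit \<open>\<bar>f\<bar>\<close> tends to
  \<open>\<bar>f x\<bar> \<noteq> 0\<close> and the imaginary part tends to \<open>0\<close>, so the constancy of \<open>h\<close> forces \<open>k = 0\<close>. Since
  \<open>\<Gamma>\<close> acts by hyperbolic isometries, \<open>\<gamma>\<^sub>n w \<longlonglongrightarrow> x\<close> for every \<open>w\<close> in the upper half-plane, whence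
  \<open>\<bar>f w\<bar> = \<bar>f x\<bar>\<close>, and \<open>f\<close> is constant by the maximum principle. A single limit point outside
  a finite set thus suffices.\<close>

section \<open>Moebius maps as hyperbolic isometries of the upper half-plane\<close>

lemma automorphy_denominator_nonzero:
  fixes A :: "real ^ 2 ^ 2"
  assumes "det A = 1" and "Im z > 0"
  shows "of_real (A $ 2 $ 1) * z + of_real (A $ 2 $ 2) \<noteq> (0::complex)"
  using assms by (auto simp: complex_eq_iff det_2)

lemma Im_mat_moebius:
  fixes A :: "real ^ 2 ^ 2"
  assumes "det A = 1"
  shows "Im (mat_moebius A z) =
    Im z / (cmod (of_real (A $ 2 $ 1) * z + of_real (A $ 2 $ 2)))\<^sup>2"
proof -
  define a b c d where "a = A $ 1 $ 1" and "b = A $ 1 $ 2"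
    and "c = A $ 2 $ 1" and "d = A $ 2 $ 2"
  have "a * d - b * c = 1"
    using assms by (simp add: det_2 a_def b_def c_def d_def)
  then have "a * Im z * (c * Re z + d) - (a * Re z + b) * (c * Im z) = Im z"
    by algebra
  then show ?thesis
    unfolding mat_moebius_def moebius_def a_def[symmetric] b_def[symmetric]
      c_def[symmetric] d_def[symmetric]
    by (simp add: Im_divide cmod_power2)
qed

lemma Im_mat_moebius_pos:
  assumes "det A = 1" and "Im z > 0"
  shows "Im (mat_moebius A z) > 0"
  using automorphy_denominator_nonzero[OF assms] assms by (simp add: Im_mat_moebius)

lemma mat_moebius_diff:
  fixes A :: "real ^ 2 ^ 2"
  assumes "det A = 1" and "Im z > 0" and "Im w > 0"
  shows "mat_moebius A z - mat_moebius A w = (z - w) /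
    ((of_real (A $ 2 $ 1) * z + of_real (A $ 2 $ 2)) * (of_real (A $ 2 $ 1) * w + of_real (A $ 2 $ 2)))"
proof -
  define a b c d where "a = complex_of_real (A $ 1 $ 1)" and "b = complex_of_real (A $ 1 $ 2)"
    and "c = complex_of_real (A $ 2 $ 1)" and "d = complex_of_real (A $ 2 $ 2)"
  have "a * d - b * c = of_real (det A)"
    by (simp add: det_2 a_def b_def c_def d_def)
  then have "a * d - b * c = 1" using assms(1) by simp
  then have *: "(a * z + b) * (c * w + d) - (a * w + b) * (c * z + d) = z - w"
    by algebra
  have "c * z + d \<noteq> 0" "c * w + d \<noteq> 0"
    using automorphy_denominator_nonzero assms by (simp_all add: c_def d_def)
  then show ?thesis
    unfolding mat_moebius_def moebius_def a_def[symmetric] b_def[symmetric]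
      c_def[symmetric] d_def[symmetric]
    by (simp add: diff_frac_eq *)
qed

text \<open>The quotient of \<open>(dist z w)\<^sup>2\<close> by \<open>Im z * Im w\<close> is
  \<open>2 * (cosh d - 1)\<close> for the hyperbolic distance \<open>d\<close>, so this is the
  invariance of \<open>d\<close>, multiplied out.\<close>

lemma hyperbolic_isometry:
  assumes "det A = 1" and "Im z > 0" and "Im w > 0"
  shows "(dist (mat_moebius A z) (mat_moebius A w))\<^sup>2 =
    (dist z w)\<^sup>2 / (Im z * Im w) * (Im (mat_moebius A z) * Im (mat_moebius A w))"
  using assms
  by (simp add: dist_norm mat_moebius_diff Im_mat_moebius norm_divide norm_mult
      power_divide power_mult_distrib)

text \<open>The factor before \<open>Im (mat_moebius A z)\<close> does not depend on
  \<open>A\<close>: when the image of \<open>z\<close> approaches the real line, the image of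
  \<open>w\<close> is dragged to the same point.\<close>

lemma dist_mat_moebius_le:
  assumes "det A = 1" and "Im z > 0" and "Im w > 0"
  shows "dist (mat_moebius A z) (mat_moebius A w) \<le>
    max 1 (2 * ((dist z w)\<^sup>2 / (Im z * Im w))) * Im (mat_moebius A z)"
proof -
  define D y \<delta> where "D = dist (mat_moebius A z) (mat_moebius A w)"
    and "y = Im (mat_moebius A z)" and "\<delta> = (dist z w)\<^sup>2 / (Im z * Im w)"
  have y: "y > 0" and \<delta>: "\<delta> \<ge> 0"
    using assms by (simp_all add: y_def \<delta>_def Im_mat_moebius_pos)
  have "\<bar>Im (mat_moebius A z - mat_moebius A w)\<bar> \<le> D"
    unfolding D_def dist_norm by (rule abs_Im_le_cmod)
  then have w: "Im (mat_moebius A w) \<le> y + D" by (simp add: y_def)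
  have "D\<^sup>2 = \<delta> * (y * Im (mat_moebius A w))"
    using hyperbolic_isometry[OF assms] by (simp add: D_def y_def \<delta>_def)
  also have "\<dots> \<le> \<delta> * (y * (y + D))"
    using w y \<delta> by (intro mult_left_mono) auto
  finally have D2: "D\<^sup>2 \<le> \<delta> * (y * (y + D))" .
  have "D \<le> max 1 (2 * \<delta>) * y"
  \<comment> \<open>If \<open>D\<close> exceeds \<open>y\<close>, then \<open>y + D\<close> is at
    most \<open>2 * D\<close>, and one factor \<open>D\<close> cancels from the quadratic bound
    \<open>D2\<close>.\<close>
  proof (cases "D \<le> y")
    case True
    moreover have "1 * y \<le> max 1 (2 * \<delta>) * y" using y by (intro mult_right_mono) auto
    ultimately show ?thesis by linarith
  next
    case False
    then have "\<delta> * (y * (y + D)) \<le> \<delta> * (y * (2 * D))"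
      using y \<delta> by (intro mult_left_mono) auto
    with D2 have "D * D \<le> (2 * \<delta> * y) * D" by (simp add: power2_eq_square algebra_simps)
    then have "D \<le> 2 * \<delta> * y" using False y by simp
    also have "\<dots> \<le> max 1 (2 * \<delta>) * y" using y by (intro mult_right_mono) auto
    finally show ?thesis .
  qed
  then show ?thesis by (simp add: D_def y_def \<delta>_def)
qed

lemma mat_moebius_tendsto_real:
  assumes "\<And>n. det (A n) = 1" and "Im z > 0" and "Im w > 0"
    and lim: "(\<lambda>n. mat_moebius (A n) z) \<longlonglongrightarrow> of_real x"
  shows "(\<lambda>n. mat_moebius (A n) w) \<longlonglongrightarrow> of_real x"
proof -
  define C where "C = max 1 (2 * ((dist z w)\<^sup>2 / (Im z * Im w)))"
  have "(\<lambda>n. C * Im (mat_moebius (A n) z)) \<longlonglongrightarrow> C * Im (of_real x)"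
    by (intro tendsto_intros lim)
  then have "(\<lambda>n. C * Im (mat_moebius (A n) z)) \<longlonglongrightarrow> 0" by simp
  moreover have "\<forall>\<^sub>F n in sequentially. norm (mat_moebius (A n) w - mat_moebius (A n) z)
      \<le> C * Im (mat_moebius (A n) z)"
    using dist_mat_moebius_le[OF assms(1-3)]
    by (simp add: C_def dist_norm norm_minus_commute)
  ultimately have "(\<lambda>n. mat_moebius (A n) w - mat_moebius (A n) z) \<longlonglongrightarrow> 0"
    by (rule Lim_null_comparison[rotated])
  from tendsto_add[OF this lim] show ?thesis by simp
qed

section \<open>Limit points and boundary points off the zeros and poles\<close>

lemma limit_set_sequence:
  assumes "Some x \<in> limit_set \<Gamma>"
  obtains A z where "\<And>n. A n \<in> SL2R_preimage \<Gamma>" and "Im z > 0"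
    and "(\<lambda>n::nat. mat_moebius (A n) z) \<longlonglongrightarrow> x"
proof -
  obtain z where z: "Im z > 0"
    and x: "Some x \<in> riemann_sphere derived_set_of (Some ` orbit_upper_half_plane \<Gamma> z)"
    using assms by (auto simp: limit_set_def upper_half_plane_def)
  have "\<exists>B\<in>SL2R_preimage \<Gamma>. dist x (mat_moebius B z) < 1 / real (Suc n)" for n
  proof -
    \<comment> \<open>Finite points of the one-point compactification keep their Euclidean
      neighbourhoods.\<close>
    have "openin riemann_sphere (Some ` ball x (1 / real (Suc n)))"
      by (auto simp: riemann_sphere_def openin_Alexandroff_compactification)
    moreover have "Some x \<in> Some ` ball x (1 / real (Suc n))" by simp
    ultimately obtain y where "y \<in> Some ` orbit_upper_half_plane \<Gamma> z"
      "y \<in> Some ` ball x (1 / real (Suc n))"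
      using x unfolding in_derived_set_of by meson
    then obtain v where "v \<in> orbit_upper_half_plane \<Gamma> z" "v \<in> ball x (1 / real (Suc n))"
      by blast
    then show ?thesis by (auto simp: orbit_upper_half_plane_def)
  qed
  then obtain A where A: "\<And>n. A n \<in> SL2R_preimage \<Gamma>"
    "\<And>n. dist x (mat_moebius (A n) z) < 1 / real (Suc n)"
    by metis
  have "(\<lambda>n. mat_moebius (A n) z - x) \<longlonglongrightarrow> 0"
  proof (rule Lim_null_comparison)
    show "\<forall>\<^sub>F n in sequentially. norm (mat_moebius (A n) z - x) \<le> 1 / real (Suc n)"
      using A(2) by (simp add: dist_norm norm_minus_commute less_imp_le)
    show "(\<lambda>n. 1 / real (Suc n)) \<longlonglongrightarrow> 0"
      using LIMSEQ_inverse_real_of_nat by (simp add: inverse_eq_divide)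
  qed
  then have "(\<lambda>n. mat_moebius (A n) z) \<longlonglongrightarrow> x" by (rule LIM_zero_cancel)
  with A(1) z show ?thesis by (rule that)
qed

lemma exists_real_nonroot:
  fixes p :: "complex poly"
  assumes "p \<noteq> 0"
  obtains x :: real where "poly p (of_real x) \<noteq> 0"
proof -
  have "finite (of_real -` {z. poly p z = 0} :: real set)"
    using poly_roots_finite[OF assms] by (intro finite_vimageI) (auto simp: inj_on_def)
  then have "of_real -` {z. poly p z = 0} \<noteq> (UNIV :: real set)"
    using infinite_UNIV_char_0 by metis
  then show ?thesis using that by auto
qed

section \<open>The invariant norm and its boundary behaviour\<close>

text \<open>Applying \<open>A\<close> multiplies the modulus of \<open>f\<close> by
  \<open>cmod j powr k\<close> and the imaginary part by \<open>cmod j powr (- 2)\<close>; the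
  exponent \<open>k / 2\<close> makes these factors cancel.\<close>

lemma automorphic_norm_invariant:
  assumes "unrestricted_automorphic_form \<Gamma> k \<nu> f" and "multiplier_system \<Gamma> k \<nu>"
    and A: "A \<in> SL2R_preimage \<Gamma>" and z: "Im z > 0"
  shows "cmod (f (mat_moebius A z)) * Im (mat_moebius A z) powr (k / 2) =
    cmod (f z) * Im z powr (k / 2)"
proof -
  define j where "j = of_real (A $ 2 $ 1) * z + of_real (A $ 2 $ 2)"
  have det: "det A = 1" using A by (simp add: SL2R_preimage_def SL2R_def)
  have j: "cmod j > 0"
    using automorphy_denominator_nonzero[OF det z] by (simp add: j_def)
  have "cmod (\<nu> A) = 1" using assms by (simp add: multiplier_system_def Let_def)
  moreover have "automorphy_power (- k) A z * f (mat_moebius A z) = \<nu> A * f z"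
    using assms by (simp add: unrestricted_automorphic_form_def upper_half_plane_def)
  \<comment> \<open>The exponent is real, so the modulus of the principal power does not see the
    argument of \<open>j\<close>.\<close>
  ultimately have f: "cmod j powr (- k) * cmod (f (mat_moebius A z)) = cmod (f z)"
    by (metis automorphy_power_def j_def mult_1 norm_mult norm_powr_real_powr'
        Reals_of_real Re_complex_of_real)
  have "Im (mat_moebius A z) = Im z * cmod j powr (- 2)"
    using j by (simp add: Im_mat_moebius[OF det] j_def powr_minus divide_simps)
  then have "Im (mat_moebius A z) powr (k / 2) = Im z powr (k / 2) * cmod j powr (- k)"
    using j z by (simp add: powr_mult powr_powr)
  then show ?thesis by (simp flip: f)
qed

text \<open>For nonzero \<open>a\<close>, taking logarithms and dividing by \<open>a\<close> would
  make \<open>ln (y n)\<close> converge, although it tends to minus infinity.\<close>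

lemma powr_tendsto_nonzero_imp_zero:
  fixes y :: "nat \<Rightarrow> real"
  assumes "\<And>n. y n > 0" and "y \<longlonglongrightarrow> 0" and "(\<lambda>n. y n powr a) \<longlonglongrightarrow> L" and "L \<noteq> 0"
  shows "a = 0"
proof (rule ccontr)
  assume a: "a \<noteq> 0"
  have "(\<lambda>n. ln (y n powr a)) \<longlonglongrightarrow> ln L" by (rule tendsto_ln[OF assms(3,4)])
  then have "(\<lambda>n. ln (y n powr a) / a) \<longlonglongrightarrow> ln L / a"
    using a by (rule tendsto_divide[OF _ tendsto_const])
  then have "(\<lambda>n. ln (y n)) \<longlonglongrightarrow> ln L / a" using a by (simp add: ln_powr)
  moreover have "filterlim (\<lambda>n. ln (y n)) at_bot sequentially"
    using assms(1,2) by (intro filterlim_compose[OF ln_at_0])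
      (auto simp: filterlim_at order_less_imp_not_eq2)
  ultimately show False
    using not_tendsto_and_filterlim_at_infinity filterlim_at_bot_imp_at_infinity
      sequentially_bot by blast
qed

lemma automorphic_rational_weight_zero_constant:
  assumes first: "first_kind \<Gamma>" and rat: "rational_function_on f upper_half_plane"
    and nz: "\<exists>z\<in>upper_half_plane. f z \<noteq> 0"
    and mult: "multiplier_system \<Gamma> k \<nu>" and form: "unrestricted_automorphic_form \<Gamma> k \<nu> f"
  shows "k = 0 \<and> f constant_on upper_half_plane"
proof -
  obtain p q where q: "q \<noteq> 0" and f: "\<And>z. Im z > 0 \<Longrightarrow> f z = poly p z / poly q z"
    using rat by (auto simp: rational_function_on_def upper_half_plane_def)
  have "p \<noteq> 0" using nz f by (auto simp: upper_half_plane_def)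
  with q obtain x :: real where "poly (p * q) (of_real x) \<noteq> 0"
    using exists_real_nonroot[of "p * q"] by auto
  then have px: "poly p (of_real x) \<noteq> 0" and qx: "poly q (of_real x) \<noteq> 0" by auto
  define L where "L = cmod (poly p (of_real x) / poly q (of_real x))"
  have L: "L > 0" using px qx by (simp add: L_def)
  have "Some (of_real x) \<in> limit_set \<Gamma>"
    using first by (auto simp: first_kind_def)
  then obtain A z where A: "\<And>n. A n \<in> SL2R_preimage \<Gamma>" and z: "Im z > 0"
    and lim: "(\<lambda>n::nat. mat_moebius (A n) z) \<longlonglongrightarrow> of_real x"
    by (rule limit_set_sequence) blast
  have det: "det (A n) = 1" for n using A by (simp add: SL2R_preimage_def SL2R_def)
  have flim: "(\<lambda>n. cmod (f (mat_moebius (A n) w))) \<longlonglongrightarrow> L" if w: "Im w > 0" for w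
  proof -
    \<comment> \<open>The limit is taken for the quotient of polynomials, which is continuous at the
      boundary point \<open>x\<close>; \<open>f\<close> is known to agree with it only inside the
      half-plane.\<close>
    have "(\<lambda>n. cmod (poly p (mat_moebius (A n) w) / poly q (mat_moebius (A n) w))) \<longlonglongrightarrow> L"
      unfolding L_def using qx
      by (intro tendsto_intros mat_moebius_tendsto_real[OF det z w lim])
    then show ?thesis using w by (simp add: f Im_mat_moebius_pos det)
  qed
  define y where "y n = Im (mat_moebius (A n) z)" for n
  have ypos: "y n > 0" for n using det z by (simp add: y_def Im_mat_moebius_pos)
  have ylim: "y \<longlonglongrightarrow> 0" using tendsto_Im[OF lim] by (simp add: y_def[abs_def])
  have inv: "cmod (f (mat_moebius (A n) z)) * y n powr (k / 2) = cmod (f z) * Im z powr (k / 2)" for n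
    unfolding y_def by (rule automorphic_norm_invariant[OF form mult A z])
  \<comment> \<open>This excludes poles as well as zeros at \<open>z\<close>, since \<open>f\<close>
    has value 0 at both. Otherwise \<open>f\<close> would vanish along the whole orbit, against the
    limit \<open>L > 0\<close>.\<close>
  have "f z \<noteq> 0"
  proof
    assume "f z = 0"
    then have "cmod (f (mat_moebius (A n) z)) = 0" for n using inv[of n] ypos[of n] by simp
    then have "L = 0" using flim[OF z] by (simp add: LIMSEQ_const_iff)
    with L show False by simp
  qed
  then have h: "cmod (f z) * Im z powr (k / 2) > 0" using z by simp
  have "cmod (f (mat_moebius (A n) z)) \<noteq> 0" for n
    using inv[of n] h by force
  then have eq: "y n powr (k / 2) = cmod (f z) * Im z powr (k / 2) / cmod (f (mat_moebius (A n) z))" for n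
    using inv[of n] by (simp add: field_simps)
  have "(\<lambda>n. y n powr (k / 2)) \<longlonglongrightarrow> cmod (f z) * Im z powr (k / 2) / L"
    unfolding eq using L by (intro tendsto_intros flim z) auto
  moreover have "cmod (f z) * Im z powr (k / 2) / L \<noteq> 0"
    using h L by (metis divide_eq_0_iff less_irrefl)
  ultimately have "k / 2 = 0" by (rule powr_tendsto_nonzero_imp_zero[OF ypos ylim])
  then have k: "k = 0" by simp
  have norm: "cmod (f w) = L" if w: "Im w > 0" for w
  proof -
    \<comment> \<open>In weight 0 the height factors are 1, so the sequence with limit
      \<open>L\<close> is constant.\<close>
    have "cmod (f (mat_moebius (A n) w)) = cmod (f w)" for n
      using automorphic_norm_invariant[OF form mult A w, of n] w det
        Im_mat_moebius_pos[of "A n" w] by (simp add: k)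
    then show ?thesis using flim[OF w] by (simp add: LIMSEQ_const_iff)
  qed
  \<comment> \<open>At a root of \<open>q\<close>, division by zero would give
    \<open>f w = 0\<close>, whereas its modulus is \<open>L > 0\<close>.\<close>
  have q0: "poly q w \<noteq> 0" if "Im w > 0" for w
    using norm[OF that] f[OF that] L by auto
  have "(\<lambda>w. poly p w / poly q w) holomorphic_on upper_half_plane"
    using q0 by (intro holomorphic_intros) (auto simp: upper_half_plane_def)
  then have "f holomorphic_on upper_half_plane"
    by (rule holomorphic_transform) (simp add: f upper_half_plane_def)
  moreover have "open upper_half_plane" "connected upper_half_plane"
    by (simp_all add: upper_half_plane_def open_halfspace_Im_gt convex_halfspace_Im_gt
        convex_connected)
  ultimately have "f constant_on upper_half_plane"
    using z norm by (intro maximum_modulus_principle[where U = upper_half_plane and \<xi> = z])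
      (auto simp: upper_half_plane_def)
  with k show ?thesis by simp
qed

section \<open>Weight zero and the trivial multiplier\<close>

text \<open>The denominator must be nonzero here, because \<open>0 powr 0 = 0\<close>.\<close>

lemma automorphy_power_0:
  assumes "A \<in> SL2R_preimage \<Gamma>" and "z \<in> upper_half_plane"
  shows "automorphy_power 0 A z = 1"
  using assms automorphy_denominator_nonzero[of A z]
  by (simp add: automorphy_power_def SL2R_preimage_def SL2R_def upper_half_plane_def)

lemma mat_moebius_upper_half_plane:
  assumes "A \<in> SL2R_preimage \<Gamma>" and "z \<in> upper_half_plane"
  shows "mat_moebius A z \<in> upper_half_plane"
  using assms Im_mat_moebius_pos
  by (simp add: SL2R_preimage_def SL2R_def upper_half_plane_def)

theorem corollary11p3:
  fixes \<Gamma> :: "(real ^ 2 ^ 2) set set" and f :: "complex \<Rightarrow> complex"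
    and k :: real and \<nu> :: "real ^ 2 ^ 2 \<Rightarrow> complex"
  assumes "fuchsian_group \<Gamma>" and "first_kind \<Gamma>"
    and "rational_function_on f upper_half_plane"
    and "\<exists>z\<in>upper_half_plane. f z \<noteq> 0"
    and "multiplier_system \<Gamma> k \<nu>"
  shows "unrestricted_automorphic_form \<Gamma> k \<nu> f \<longleftrightarrow>
    k = 0 \<and> (\<forall>A\<in>SL2R_preimage \<Gamma>. \<nu> A = 1) \<and> f constant_on upper_half_plane"
proof
  assume form: "unrestricted_automorphic_form \<Gamma> k \<nu> f"
  have k: "k = 0" and const: "f constant_on upper_half_plane"
    using automorphic_rational_weight_zero_constant[OF assms(2-5) form] by auto
  obtain z where z: "z \<in> upper_half_plane" "f z \<noteq> 0" using assms(4) by blast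
  \<comment> \<open>In weight 0 the transformation law at \<open>z\<close> compares the nonzero
    constant value of \<open>f\<close> with \<open>\<nu> A\<close> times itself.\<close>
  have "\<nu> A = 1" if A: "A \<in> SL2R_preimage \<Gamma>" for A
  proof -
    have "automorphy_power (- k) A z * f (mat_moebius A z) = \<nu> A * f z"
      using form A z(1) by (simp add: unrestricted_automorphic_form_def)
    then have "f (mat_moebius A z) = \<nu> A * f z"
      using automorphy_power_0[OF A z(1)] by (simp add: k)
    moreover have "f (mat_moebius A z) = f z"
      using const mat_moebius_upper_half_plane[OF A z(1)] z(1) by (auto simp: constant_on_def)
    ultimately show ?thesis using z(2) by simp
  qed
  with k const show "k = 0 \<and> (\<forall>A\<in>SL2R_preimage \<Gamma>. \<nu> A = 1) \<and> f constant_on upper_half_plane"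
    by blast
next
  assume *: "k = 0 \<and> (\<forall>A\<in>SL2R_preimage \<Gamma>. \<nu> A = 1) \<and> f constant_on upper_half_plane"
  then obtain c where c: "\<And>z. z \<in> upper_half_plane \<Longrightarrow> f z = c" by (auto simp: constant_on_def)
  have "f holomorphic_on upper_half_plane"
    by (rule holomorphic_transform[of "\<lambda>_. c"]) (simp_all add: c)
  then have "f analytic_on upper_half_plane"
    by (simp add: analytic_on_open upper_half_plane_def open_halfspace_Im_gt)
  then show "unrestricted_automorphic_form \<Gamma> k \<nu> f"
    using * c automorphy_power_0 mat_moebius_upper_half_plane
    by (auto simp: unrestricted_automorphic_form_def intro: analytic_on_imp_nicely_meromorphic_on)
qed

end
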